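(* Let $\mathcal{H}_1,\mathcal{H}_2$ be real or complex Hilbert spaces, $M=\mathcal{H}_1\oplus\{0\}$, $N=\mathcal{H}_2\oplus\{0\}$, $\lambda>0$, and let $A,B\in\mathcal{B}(\mathcal{H}_1,\mathcal{H}_2)$ be such that $T=\begin{pmatrix} A & A \\ A & A+B \end{pmatrix}\in\mathcal{B}(\mathcal{H}_1\oplus\mathcal{H}_1,\mathcal{H}_2\oplus\mathcal{H}_2)$ is $(M,N,\lambda)$-complementable. Then $$\|T\|\le\sqrt{3\lambda^2+1}\,\|A+B\|.$$ Moreover, if $A^*(2A+B)=0$ and both $A:B$ and $B$ are bounded below, then $$\min\Big\{\frac{\gamma(A:B)}{1+\lambda},\frac{\gamma(B)}{2}\Big\}\le\|T\|\le\sqrt{3\lambda^2+1}\,\|A+B\|.$$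
   Context: $\mathcal{R}(\cdot)$, $\mathcal{N}(\cdot)$ denote range and null space. For a Hilbert space $W$, $\mathcal{B}_W=\{x\in W:\|x\|\le1\}$. $T$ is $(M,N,\lambda)$-complementable ($\lambda>0$) if $A(\mathcal{B}_{\mathcal{H}_1})\subseteq\lambda(A+B)(\mathcal{B}_{\mathcal{H}_1})$ and $A^*(\mathcal{B}_{\mathcal{H}_2})\subseteq\lambda(A+B)^*(\mathcal{B}_{\mathcal{H}_2})$; in particular $\mathcal{R}(A)\subseteq\mathcal{R}(A+B)$ and $\mathcal{R}(A^* )\subseteq\mathcal{R}(A^*+B^* )$. (This is the specialization to this $T,M,N$ of the general notion: a block operator $\begin{pmatrix} P & Q \\ R & S \end{pmatrix}$ with respect to $M\oplus M^\perp$, $N\oplus N^\perp$ is $(M,N,\lambda)$-complementable if $R(\mathcal{B}_M)\subseteq\lambda S(\mathcal{B}_{M^\perp})$ and $Q^*(\mathcal{B}_N)\subseteq\lambda S^*(\mathcal{B}_{N^\perp})$.) If $\mathcal{R}(A_1)\subseteq\mathcal{R}(B_1)$ for bounded operators $A_1,B_1$ with the same codomain, the Douglas reduced solution of $A_1=B_1X$ is the unique bounded $C_1$ with $A_1=B_1C_1$ and $\mathcal{R}(C_1)\subseteq\mathcal{N}(B_1)^\perp$. The parallel sum is $A:B=A-AZ=A-YA\in\mathcal{B}(\mathcal{H}_1,\mathcal{H}_2)$, where $Z$ is the Douglas reduced solution of $A=(A+B)X$ and $Y^*$ is the Douglas reduced solution of $A^*=(A+B)^*X$. An operator $S$ is bounded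 below if there is $c>0$ with $\|Sx\|\ge c\|x\|$ for all $x$. The reduced minimum modulus is $\gamma(S)=\inf\{\|Sx\|:x\in\mathcal{N}(S)^\perp,\ \|x\|=1\}$. *)

theory Defs
  imports "HOL-Analysis.Analysis"
begin

text \<open>
  The scalar field. By the theorems of Ostrowski and Gelfand--Mazur, a real normed field (a field
  containing the reals, with multiplicative norm) is \<open>\<real>\<close> or \<open>\<complex>\<close>, and
  the two axioms determine \<open>kcnj\<close> uniquely as \<open>kcnj x = (norm x)\<^sup>2 / x\<close>, that is,
  the identity on \<open>\<real>\<close> and complex conjugation on \<open>\<complex>\<close>. So this class says
  exactly ``real or complex''.
\<close>

class real_or_complex = real_normed_field +
  fixes kcnj :: "'a \<Rightarrow> 'a"
  assumes kcnj_add: "kcnj (x + y) = kcnj x + kcnj y"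
    and mult_kcnj: "x * kcnj x = (norm x)\<^sup>2 *\<^sub>R 1"

instantiation real :: real_or_complex
begin
definition kcnj_real :: "real \<Rightarrow> real" where "kcnj_real x = x"
instance by standard (simp_all add: kcnj_real_def power2_eq_square)
end

instantiation complex :: real_or_complex
begin
definition kcnj_complex :: "complex \<Rightarrow> complex" where "kcnj_complex x = cnj x"
instance by standard (simp_all add: kcnj_complex_def complex_norm_square[symmetric] scaleR_conv_of_real del: of_real_power)
end

text \<open>
  A Hilbert space over \<open>'k\<close> lives on a whole type \<open>'a\<close>, whose additive group, norm and
  completeness come from the class \<open>banach\<close>; the record supplies the scalar action of
  \<open>'k\<close> and the inner product, which is linear in its first argument. All operators below
  are plain functions, and linearity and boundedness are stated by \<open>bounded_op\<close>.
\<close>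

record ('k, 'a) hilbert =
  smul :: "'k \<Rightarrow> 'a \<Rightarrow> 'a"
  ip :: "'a \<Rightarrow> 'a \<Rightarrow> 'k"

locale hilbert_space =
  fixes H :: "('k::real_or_complex, 'a::banach) hilbert"
  assumes vector_space: "vector_space (smul H)"
    and smul_of_real: "smul H (of_real r) x = r *\<^sub>R x"
    and ip_add_left: "ip H (x + y) z = ip H x z + ip H y z"
    and ip_smul_left: "ip H (smul H c x) y = c * ip H x y"
    and ip_commute: "ip H x y = kcnj (ip H y x)"
    and ip_self: "ip H x x = of_real ((norm x)\<^sup>2)"

definition bounded_op ::
  "('k::real_or_complex, 'a::banach) hilbert \<Rightarrow> ('k, 'b::banach) hilbert \<Rightarrow> ('a \<Rightarrow> 'b) \<Rightarrow> bool"
  where "bounded_op H1 H2 S \<longleftrightarrow>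
    Vector_Spaces.linear (smul H1) (smul H2) S \<and> (\<exists>K. \<forall>x. norm (S x) \<le> K * norm x)"

definition null_space :: "('a \<Rightarrow> 'b::zero) \<Rightarrow> 'a set"
  where "null_space S = {x. S x = 0}"

definition orth_compl :: "('k::real_or_complex, 'a::banach) hilbert \<Rightarrow> 'a set \<Rightarrow> 'a set"
  where "orth_compl H M = {x. \<forall>y\<in>M. ip H x y = 0}"

text \<open>Used only for closed subspaces \<open>M\<close>.\<close>

definition orth_proj :: "('k::real_or_complex, 'a::banach) hilbert \<Rightarrow> 'a set \<Rightarrow> 'a \<Rightarrow> 'a"
  where "orth_proj H M x = (THE y. y \<in> M \<and> x - y \<in> orth_compl H M)"

definition adj ::
  "('k::real_or_complex, 'a::banach) hilbert \<Rightarrow> ('k, 'b::banach) hilbert \<Rightarrow> ('a \<Rightarrow> 'b) \<Rightarrow> 'b \<Rightarrow> 'a"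
  where "adj H1 H2 S = (THE S'. \<forall>x y. ip H2 (S x) y = ip H1 x (S' y))"

text \<open>The norm of a product type is \<open>sqrt ((norm x)\<^sup>2 + (norm y)\<^sup>2)\<close>, which is the
  norm of the Hilbert space direct sum.\<close>

definition hilbert_sum ::
  "('k::real_or_complex, 'a::banach) hilbert \<Rightarrow> ('k, 'b::banach) hilbert \<Rightarrow> ('k, 'a \<times> 'b) hilbert"
  where "hilbert_sum H1 H2 =
    \<lparr> smul = (\<lambda>c (x, y). (smul H1 c x, smul H2 c y)),
      ip = (\<lambda>(x, y) (x', y'). ip H1 x x' + ip H2 y y') \<rparr>"

definition block_op ::
  "('a \<Rightarrow> 'c) \<Rightarrow> ('b \<Rightarrow> 'c) \<Rightarrow> ('a \<Rightarrow> 'd) \<Rightarrow> ('b \<Rightarrow> 'd) \<Rightarrow> 'a \<times> 'b \<Rightarrow> 'c::plus \<times> 'd::plus"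
  where "block_op P Q R S = (\<lambda>(x, y). (P x + Q y, R x + S y))"

text \<open>
  The entry of \<open>T\<close> from the closed subspace \<open>K\<close> to the closed subspace \<open>L\<close>, extended
  by zero on the orthogonal complement of \<open>K\<close>; the adjoint of this extension restricts on
  \<open>L\<close> to the adjoint of the entry \<open>K \<rightarrow> L\<close>.
\<close>

definition entry ::
  "('k::real_or_complex, 'a::banach) hilbert \<Rightarrow> ('k, 'b::banach) hilbert \<Rightarrow>
    'a set \<Rightarrow> 'b set \<Rightarrow> ('a \<Rightarrow> 'b) \<Rightarrow> 'a \<Rightarrow> 'b"
  where "entry H1 H2 K L T = (\<lambda>x. orth_proj H2 L (T (orth_proj H1 K x)))"

text \<open>
  For \<open>T\<close> with block matrix \<open>(P, Q; R, S)\<close> with respect to \<open>M \<oplus> M\<^sup>\<bottom>\<close> and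
  \<open>N \<oplus> N\<^sup>\<bottom>\<close>: \<open>R\<close> maps the unit ball of \<open>M\<close> into \<open>l\<close> times the image under
  \<open>S\<close> of the unit ball of \<open>M\<^sup>\<bottom>\<close>, and likewise for the adjoints of \<open>Q\<close> and \<open>S\<close>.
\<close>

definition complementable ::
  "('k::real_or_complex, 'a::banach) hilbert \<Rightarrow> ('k, 'b::banach) hilbert \<Rightarrow>
    'a set \<Rightarrow> 'b set \<Rightarrow> real \<Rightarrow> ('a \<Rightarrow> 'b) \<Rightarrow> bool"
  where "complementable H1 H2 M N l T \<longleftrightarrow>
    (let M' = orth_compl H1 M; N' = orth_compl H2 N;
         Q = entry H1 H2 M' N T; R = entry H1 H2 M N' T; S = entry H1 H2 M' N' T
     in R ` (cball 0 1 \<inter> M) \<subseteq> (*\<^sub>R) l ` S ` (cball 0 1 \<inter> M') \<and>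
        adj H1 H2 Q ` (cball 0 1 \<inter> N) \<subseteq> (*\<^sub>R) l ` adj H1 H2 S ` (cball 0 1 \<inter> N'))"

text \<open>The Douglas reduced solution \<open>X\<close> of \<open>A1 = B1 X\<close>, where \<open>A1 : H1 \<rightarrow> H3\<close> and
  \<open>B1 : H2 \<rightarrow> H3\<close> with \<open>range A1 \<subseteq> range B1\<close>.\<close>

definition douglas_reduced ::
  "('k::real_or_complex, 'a::banach) hilbert \<Rightarrow> ('k, 'b::banach) hilbert \<Rightarrow>
    ('a \<Rightarrow> 'c::zero) \<Rightarrow> ('b \<Rightarrow> 'c) \<Rightarrow> 'a \<Rightarrow> 'b"
  where "douglas_reduced H1 H2 A1 B1 =
    (THE C. bounded_op H1 H2 C \<and> A1 = B1 \<circ> C \<and> range C \<subseteq> orth_compl H2 (null_space B1))"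

text \<open>\<open>A : B = A - A Z\<close> with \<open>Z\<close> the reduced solution of \<open>A = (A + B) X\<close>.\<close>

definition parallel_sum ::
  "('k::real_or_complex, 'a::banach) hilbert \<Rightarrow> ('a \<Rightarrow> 'b::banach) \<Rightarrow> ('a \<Rightarrow> 'b) \<Rightarrow> 'a \<Rightarrow> 'b"
  where "parallel_sum H1 A B =
    (\<lambda>x. A x - A (douglas_reduced H1 H1 A (\<lambda>x. A x + B x) x))"

definition bounded_below :: "('a::real_normed_vector \<Rightarrow> 'b::real_normed_vector) \<Rightarrow> bool"
  where "bounded_below S \<longleftrightarrow> (\<exists>c>0. \<forall>x. c * norm x \<le> norm (S x))"

text \<open>Extended-real valued, so that the infimum over the empty set (the case \<open>S = 0\<close>) is
  \<open>\<infinity>\<close>.\<close>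

definition reduced_min_modulus ::
  "('k::real_or_complex, 'a::banach) hilbert \<Rightarrow> ('a \<Rightarrow> 'b::banach) \<Rightarrow> ereal"
  where "reduced_min_modulus H1 S =
    (INF x \<in> {x \<in> orth_compl H1 (null_space S). norm x = 1}. ereal (norm (S x)))"

text \<open>The real and complex inner product spaces of the library are instances, and direct sums of
  Hilbert spaces are Hilbert spaces.\<close>

lemma hilbert_space_real:
  "hilbert_space \<lparr> smul = scaleR, ip = (inner :: 'a::{real_inner,banach} \<Rightarrow> 'a \<Rightarrow> real) \<rparr>"
  by standard
    (simp_all add: kcnj_real_def inner_add_left inner_commute power2_norm_eq_inner algebra_simps)

lemma hilbert_space_complex:
  "hilbert_space \<lparr> smul = (*), ip = (\<lambda>x y :: complex. x * cnj y) \<rparr>"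
  by standard
    (simp_all add: kcnj_complex_def complex_norm_square[symmetric] algebra_simps
      scaleR_conv_of_real del: of_real_power)

lemma hilbert_space_sum:
  assumes "hilbert_space H1" "hilbert_space H2"
  shows "hilbert_space (hilbert_sum H1 H2)"
proof -
  interpret h1: hilbert_space H1 by fact
  interpret h2: hilbert_space H2 by fact
  interpret v1: vector_space "smul H1" by (rule h1.vector_space)
  interpret v2: vector_space "smul H2" by (rule h2.vector_space)
  show ?thesis
  proof
    fix a b :: 'a and x y z :: "'b \<times> 'c" and r :: real
    show "smul (hilbert_sum H1 H2) a (x + y) = smul (hilbert_sum H1 H2) a x + smul (hilbert_sum H1 H2) a y"
      "smul (hilbert_sum H1 H2) (a + b) x = smul (hilbert_sum H1 H2) a x + smul (hilbert_sum H1 H2) b x"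
      "smul (hilbert_sum H1 H2) a (smul (hilbert_sum H1 H2) b x) = smul (hilbert_sum H1 H2) (a * b) x"
      "smul (hilbert_sum H1 H2) 1 x = x"
      by (simp_all add: hilbert_sum_def split_beta v1.scale_right_distrib v2.scale_right_distrib
          v1.scale_left_distrib v2.scale_left_distrib)
    show "smul (hilbert_sum H1 H2) (of_real r) x = r *\<^sub>R x"
      by (simp add: hilbert_sum_def split_beta h1.smul_of_real h2.smul_of_real prod_eq_iff)
    show "ip (hilbert_sum H1 H2) (x + y) z = ip (hilbert_sum H1 H2) x z + ip (hilbert_sum H1 H2) y z"
      by (simp add: hilbert_sum_def split_beta h1.ip_add_left h2.ip_add_left)
    show "ip (hilbert_sum H1 H2) (smul (hilbert_sum H1 H2) a x) y = a * ip (hilbert_sum H1 H2) x y"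
      by (simp add: hilbert_sum_def split_beta h1.ip_smul_left h2.ip_smul_left distrib_left)
    show "ip (hilbert_sum H1 H2) x y = kcnj (ip (hilbert_sum H1 H2) y x)"
      by (simp add: hilbert_sum_def split_beta kcnj_add h1.ip_commute[symmetric] h2.ip_commute[symmetric])
    show "ip (hilbert_sum H1 H2) x x = of_real ((norm x)\<^sup>2)"
      by (simp add: hilbert_sum_def split_beta h1.ip_self h2.ip_self norm_prod_def)
  qed
qed

text \<open>For block operators between direct sums and \<open>M\<close>, \<open>N\<close> the first summands,
  complementability is the expected condition on the four given blocks. The adjoints \<open>Q'\<close>
  and \<open>S'\<close> exist for all bounded \<open>Q\<close> and \<open>S\<close> by the Riesz representation
  theorem.\<close>

lemma (in hilbert_space) ip_nondegenerate: "ip H x x = 0 \<longleftrightarrow> x = 0"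
  by (simp add: ip_self)

lemma (in hilbert_space) ip_zero_left [simp]: "ip H 0 y = 0"
  using ip_add_left[of 0 0 y] by simp

lemma (in hilbert_space) kcnj_zero: "kcnj (0 :: 'k) = 0"
  using kcnj_add[of "0 :: 'k" 0] by simp

lemma (in hilbert_space) ip_zero_right [simp]: "ip H x 0 = 0"
  using ip_commute[of x 0] kcnj_zero by simp

lemma (in hilbert_space) ip_eq_right:
  assumes "\<And>x. ip H x y = ip H x z"
  shows "y = z"
proof -
  have m: "ip H a (b - c) = ip H a b - ip H a c" for a b c
  proof -
    have "ip H a (u + v) = ip H a u + ip H a v" for u v
      by (metis ip_commute ip_add_left kcnj_add)
    from this[of "b - c" c] show ?thesis by simp
  qed
  have "ip H (y - z) (y - z) = 0"
    using assms m by simp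
  then show ?thesis
    using ip_nondegenerate by simp
qed

lemma adj_eqI:
  assumes "hilbert_space H1" "\<And>x y. ip H2 (S x) y = ip H1 x (S' y)"
  shows "adj H1 H2 S = S'"
  unfolding adj_def
proof (rule the_equality)
  show "\<forall>x y. ip H2 (S x) y = ip H1 x (S' y)"
    using assms by blast
  show "R = S'" if "\<forall>x y. ip H2 (S x) y = ip H1 x (R y)" for R
    by (rule ext) (metis assms hilbert_space.ip_eq_right that)
qed

lemma cball_summand:
  "cball 0 1 \<inter> (UNIV \<times> {0}) =
    (\<lambda>x::'a::real_normed_vector. (x, 0::'b::real_normed_vector)) ` cball 0 1"
  "cball 0 1 \<inter> ({0} \<times> UNIV) =
    (\<lambda>y::'b::real_normed_vector. (0::'a::real_normed_vector, y)) ` cball 0 1"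
  by (auto simp: norm_prod_def)

lemma complementable_block_op:
  fixes P :: "'a::banach \<Rightarrow> 'c::banach" and Q :: "'b::banach \<Rightarrow> 'c"
    and R :: "'a \<Rightarrow> 'd::banach" and S :: "'b \<Rightarrow> 'd"
    and H1 :: "('k::real_or_complex, 'a) hilbert"
  assumes H: "hilbert_space H1" "hilbert_space H2" "hilbert_space H3" "hilbert_space H4"
    and 0: "P 0 = 0" "Q 0 = 0" "R 0 = 0" "S 0 = 0"
    and Q': "\<And>x y. ip H3 (Q x) y = ip H2 x (Q' y)"
    and S': "\<And>x y. ip H4 (S x) y = ip H2 x (S' y)"
  shows "complementable (hilbert_sum H1 H2) (hilbert_sum H3 H4) (UNIV \<times> {0}) (UNIV \<times> {0}) l (block_op P Q R S)
    \<longleftrightarrow> R ` cball 0 1 \<subseteq> (*\<^sub>R) l ` S ` cball 0 1 \<and>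
        adj H2 H3 Q ` cball 0 1 \<subseteq> (*\<^sub>R) l ` adj H2 H4 S ` cball 0 1"
proof -
  have oc: "orth_compl (hilbert_sum G K) (UNIV \<times> {0}) = {0} \<times> UNIV"
    if "hilbert_space G" "hilbert_space K"
    for G :: "('k, 'x::banach) hilbert" and K :: "('k, 'y::banach) hilbert"
    using hilbert_space.ip_nondegenerate[OF that(1)] hilbert_space.ip_zero_left[OF that(1)]
      hilbert_space.ip_zero_right[OF that(2)]
    by (fastforce simp: orth_compl_def hilbert_sum_def)
  have oc': "orth_compl (hilbert_sum G K) ({0} \<times> UNIV) = UNIV \<times> {0}"
    if "hilbert_space G" "hilbert_space K"
    for G :: "('k, 'x::banach) hilbert" and K :: "('k, 'y::banach) hilbert"
    using hilbert_space.ip_nondegenerate[OF that(2)] hilbert_space.ip_zero_left[OF that(2)]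
      hilbert_space.ip_zero_right[OF that(1)]
    by (fastforce simp: orth_compl_def hilbert_sum_def)
  have pr: "orth_proj (hilbert_sum G K) (UNIV \<times> {0}) (x, y) = (x, 0)"
    "orth_proj (hilbert_sum G K) ({0} \<times> UNIV) (x, y) = (0, y)"
    if "hilbert_space G" "hilbert_space K"
    for G :: "('k, 'x::banach) hilbert" and K :: "('k, 'y::banach) hilbert" and x y
    unfolding orth_proj_def oc[OF that] oc'[OF that] by (rule the_equality; auto)+
  have e: "entry (hilbert_sum H1 H2) (hilbert_sum H3 H4) (UNIV \<times> {0}) ({0} \<times> UNIV) (block_op P Q R S) = (\<lambda>(x, y). (0, R x))"
    "entry (hilbert_sum H1 H2) (hilbert_sum H3 H4) ({0} \<times> UNIV) ({0} \<times> UNIV) (block_op P Q R S) = (\<lambda>(x, y). (0, S y))"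
    "entry (hilbert_sum H1 H2) (hilbert_sum H3 H4) ({0} \<times> UNIV) (UNIV \<times> {0}) (block_op P Q R S) = (\<lambda>(x, y). (Q y, 0))"
    using 0 by (auto simp: entry_def block_op_def pr[OF H(1,2)] pr[OF H(3,4)] fun_eq_iff)
  have aQ: "adj H2 H3 Q = Q'" and aS: "adj H2 H4 S = S'"
    using adj_eqI[OF H(2)] Q' S' by blast+
  have aQ2: "adj (hilbert_sum H1 H2) (hilbert_sum H3 H4) (\<lambda>(x, y). (Q y, 0)) = (\<lambda>(x, y). (0, Q' x))"
    using Q' by (intro adj_eqI hilbert_space_sum H)
      (auto simp: hilbert_sum_def hilbert_space.ip_zero_left[OF H(4)] hilbert_space.ip_zero_right[OF H(1)])
  have aS2: "adj (hilbert_sum H1 H2) (hilbert_sum H3 H4) (\<lambda>(x, y). (0, S y)) = (\<lambda>(x, y). (0, S' y))"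
    using S' by (intro adj_eqI hilbert_space_sum H)
      (auto simp: hilbert_sum_def hilbert_space.ip_zero_left[OF H(3)] hilbert_space.ip_zero_right[OF H(1)])
  show ?thesis
    unfolding complementable_def oc[OF H(1,2)] oc[OF H(3,4)] Let_def e aQ2 aS2 aQ aS cball_summand image_image
    by (auto simp: image_iff subset_iff)
qed

end

theory Submission
  imports Defs
begin

text \<open>
  Complementability says in particular that every vector \<open>A x\<close> with \<open>norm x \<le> 1\<close> is
  \<open>l\<close> times a value of \<open>A + B\<close> on the unit ball. Hence \<open>A\<close> has norm at most
  \<open>l\<close> times the norm of \<open>A + B\<close> (\<open>onorm_le_of_image_cball_subset\<close>). The norm of a
  \<open>2 \<times> 2\<close> block operator is at most the Euclidean norm of its four block norms
  (\<open>onorm_block_op_le\<close>), and with three blocks \<open>A\<close> and one block \<open>A + B\<close> this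
  is the factor \<open>sqrt (3 * l\<^sup>2 + 1)\<close>.

  The lower bound comes from the second term of the minimum. The operator \<open>T\<close> takes
  \<open>(- x, x)\<close> to \<open>(0, B x)\<close>, so the norm of \<open>B\<close> is at most \<open>sqrt 2\<close> times
  that of \<open>T\<close>; and for an injective operator on a nonzero space the reduced minimum
  modulus is an infimum over all unit vectors, so that it is at most the norm.
\<close>

lemma bounded_op_imp_bounded_linear:
  assumes "hilbert_space H1" "hilbert_space H2" "bounded_op H1 H2 S"
  shows "bounded_linear S"
proof -
  interpret h1: hilbert_space H1 by fact
  interpret h2: hilbert_space H2 by fact
  have lin: "Vector_Spaces.linear (smul H1) (smul H2) S"
    using assms(3) by (simp add: bounded_op_def)
  obtain K where K: "\<And>x. norm (S x) \<le> K * norm x"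
    using assms(3) by (auto simp: bounded_op_def)
  show ?thesis
  proof (rule bounded_linear_intro)
    show "S (x + y) = S x + S y" for x y
      using lin by (simp add: Vector_Spaces.linear_iff)
    show "S (r *\<^sub>R x) = r *\<^sub>R S x" for r x
      using lin unfolding Vector_Spaces.linear_iff by (metis h1.smul_of_real h2.smul_of_real)
    show "norm (S x) \<le> norm x * K" for x
      using K[of x] by (simp add: mult.commute)
  qed
qed

lemma orth_compl_first_summand:
  assumes "hilbert_space G" "hilbert_space K"
  shows "orth_compl (hilbert_sum G K) (UNIV \<times> {0}) = {0} \<times> UNIV"
  using hilbert_space.ip_nondegenerate[OF assms(1)] hilbert_space.ip_zero_left[OF assms(1)]
    hilbert_space.ip_zero_right[OF assms(2)]
  by (fastforce simp: orth_compl_def hilbert_sum_def)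

lemma orth_proj_summands:
  assumes "hilbert_space G" "hilbert_space K"
  shows "orth_proj (hilbert_sum G K) (UNIV \<times> {0}) (x, y) = (x, 0)"
    and "orth_proj (hilbert_sum G K) ({0} \<times> UNIV) (x, y) = (0, y)"
proof -
  have "orth_compl (hilbert_sum G K) ({0} \<times> UNIV) = UNIV \<times> {0}"
    using hilbert_space.ip_nondegenerate[OF assms(2)] hilbert_space.ip_zero_left[OF assms(2)]
      hilbert_space.ip_zero_right[OF assms(1)]
    by (fastforce simp: orth_compl_def hilbert_sum_def)
  note oc = orth_compl_first_summand[OF assms] this
  show "orth_proj (hilbert_sum G K) (UNIV \<times> {0}) (x, y) = (x, 0)"
    and "orth_proj (hilbert_sum G K) ({0} \<times> UNIV) (x, y) = (0, y)"
    unfolding orth_proj_def oc by (rule the_equality; auto)+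
qed

text \<open>
  The half of complementability that concerns the operator itself and not its adjoint. It is
  extracted separately because, unlike the equivalence \<open>complementable_block_op\<close>, it can be
  read off without knowing that the blocks have adjoints, so the Riesz theorem is avoided.
\<close>

lemma complementable_block_opD:
  fixes P :: "'a::banach \<Rightarrow> 'c::banach" and Q :: "'b::banach \<Rightarrow> 'c"
    and R :: "'a \<Rightarrow> 'd::banach" and S :: "'b \<Rightarrow> 'd"
    and H1 :: "('k::real_or_complex, 'a) hilbert"
  assumes H: "hilbert_space H1" "hilbert_space H2" "hilbert_space H3" "hilbert_space H4"
    and 0: "R 0 = 0" "S 0 = 0"
    and c: "complementable (hilbert_sum H1 H2) (hilbert_sum H3 H4)
      (UNIV \<times> {0}) (UNIV \<times> {0}) l (block_op P Q R S)"
  shows "R ` cball 0 1 \<subseteq> (*\<^sub>R) l ` S ` cball 0 1"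
proof -
  have "entry (hilbert_sum H1 H2) (hilbert_sum H3 H4) (UNIV \<times> {0}) ({0} \<times> UNIV)
      (block_op P Q R S) = (\<lambda>(x, y). (0, R x))"
    and "entry (hilbert_sum H1 H2) (hilbert_sum H3 H4) ({0} \<times> UNIV) ({0} \<times> UNIV)
      (block_op P Q R S) = (\<lambda>(x, y). (0, S y))"
    using 0 by (auto simp: entry_def block_op_def fun_eq_iff
        orth_proj_summands[OF H(1,2)] orth_proj_summands[OF H(3,4)])
  then have "(\<lambda>x. (0::'c, R x)) ` cball 0 1 \<subseteq> (\<lambda>y. (0, l *\<^sub>R S y)) ` cball 0 1"
    using c by (simp add: complementable_def Let_def cball_summand image_image
        orth_compl_first_summand[OF H(1,2)] orth_compl_first_summand[OF H(3,4)])
  then show ?thesis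
    by (auto simp: image_iff subset_iff)
qed

lemma onorm_le_of_image_cball_subset:
  assumes R: "bounded_linear R" and S: "bounded_linear S" and l: "0 \<le> l"
    and sub: "R ` cball 0 1 \<subseteq> (*\<^sub>R) l ` S ` cball 0 1"
  shows "onorm R \<le> l * onorm S"
proof (rule onorm_bound)
  interpret R: bounded_linear R by fact
  show nonneg: "0 \<le> l * onorm S"
    using l onorm_pos_le[OF S] by simp
  show "norm (R x) \<le> l * onorm S * norm x" for x
  proof (cases "x = 0")
    case False
    define u where "u = x /\<^sub>R norm x"
    have "norm u \<le> 1"
      using False by (simp add: u_def)
    then have "R u \<in> R ` cball 0 1"
      by simp
    then obtain y where y: "norm y \<le> 1" "R u = l *\<^sub>R S y"
      using sub by auto
    have "norm (S y) \<le> onorm S * norm y"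
      by (rule onorm[OF S])
    also have "\<dots> \<le> onorm S"
      using y(1) onorm_pos_le[OF S] by (simp add: mult_left_le)
    finally have "norm (R u) \<le> l * onorm S"
      using y(2) l by (simp add: mult_left_mono)
    moreover have "R x = norm x *\<^sub>R R u"
      using False by (simp add: u_def R.scaleR)
    ultimately show ?thesis
      using mult_right_mono[of "norm (R u)" "l * onorm S" "norm x"] by (simp add: mult.commute)
  qed (simp add: R.zero)
qed

lemma bounded_linear_block_op:
  assumes "bounded_linear P" "bounded_linear Q" "bounded_linear R" "bounded_linear S"
  shows "bounded_linear (block_op P Q R S)"
  unfolding block_op_def split_beta
  by (intro bounded_linear_Pair bounded_linear_add
      bounded_linear_compose[OF assms(1) bounded_linear_fst]
      bounded_linear_compose[OF assms(2) bounded_linear_snd]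
      bounded_linear_compose[OF assms(3) bounded_linear_fst]
      bounded_linear_compose[OF assms(4) bounded_linear_snd])

text \<open>
  The triangle inequality bounds each row by a scalar product of \<open>(norm x, norm y)\<close> with the
  block norms of that row, so Cauchy--Schwarz bounds the operator by the Frobenius norm of the
  matrix of block norms.
\<close>

lemma onorm_block_op_le:
  assumes P: "bounded_linear P" and Q: "bounded_linear Q"
    and R: "bounded_linear R" and S: "bounded_linear S"
  shows "onorm (block_op P Q R S)
    \<le> sqrt ((onorm P)\<^sup>2 + (onorm Q)\<^sup>2 + (onorm R)\<^sup>2 + (onorm S)\<^sup>2)"
proof (rule onorm_bound)
  have row: "(norm (F x + G y))\<^sup>2
      \<le> ((onorm F)\<^sup>2 + (onorm G)\<^sup>2) * ((norm x)\<^sup>2 + (norm y)\<^sup>2)"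
    if F: "bounded_linear F" and G: "bounded_linear G"
    for F :: "'x::real_normed_vector \<Rightarrow> 'z::real_normed_vector"
      and G :: "'y::real_normed_vector \<Rightarrow> 'z" and x y
  proof -
    have "norm (F x + G y) \<le> onorm F * norm x + onorm G * norm y"
      using norm_triangle_ineq[of "F x" "G y"] onorm[OF F, of x] onorm[OF G, of y] by linarith
    then have "(norm (F x + G y))\<^sup>2 \<le> (onorm F * norm x + onorm G * norm y)\<^sup>2"
      by (rule power_mono) simp
    also have "\<dots> = ((onorm F)\<^sup>2 + (onorm G)\<^sup>2) * ((norm x)\<^sup>2 + (norm y)\<^sup>2)
        - (onorm F * norm y - onorm G * norm x)\<^sup>2"
      by (simp add: power2_eq_square algebra_simps)
    finally show ?thesis
      using zero_le_power2[of "onorm F * norm y - onorm G * norm x"] by linarith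
  qed
  show "norm (block_op P Q R S z)
      \<le> sqrt ((onorm P)\<^sup>2 + (onorm Q)\<^sup>2 + (onorm R)\<^sup>2 + (onorm S)\<^sup>2) * norm z" for z
  proof (cases z)
    case (Pair x y)
    show ?thesis
      using add_mono[OF row[OF P Q, of x y] row[OF R S, of x y]]
      by (simp add: Pair block_op_def norm_prod_def real_sqrt_mult[symmetric] algebra_simps)
  qed
qed simp

text \<open>
  In \<open>T\<close> the first block row and the two blocks \<open>A\<close> cancel on antidiagonal vectors, which
  isolates \<open>B\<close>; the factor is the norm of \<open>(- x, x)\<close> for a unit vector \<open>x\<close>.
\<close>

lemma norm_le_onorm_block_op:
  assumes A: "bounded_linear A" and B: "bounded_linear B"
  shows "norm (B x) \<le> sqrt 2 * onorm (block_op A A A (\<lambda>x. A x + B x)) * norm x"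
proof -
  have T: "bounded_linear (block_op A A A (\<lambda>x. A x + B x))"
    by (intro bounded_linear_block_op bounded_linear_add A B)
  have "block_op A A A (\<lambda>x. A x + B x) (- x, x) = (0, B x)"
    by (simp add: block_op_def linear_neg[OF bounded_linear.linear[OF A]])
  moreover have "norm (- x, x) = sqrt 2 * norm x"
    by (simp add: norm_prod_def real_sqrt_mult flip: mult_2)
  ultimately show ?thesis
    using onorm[OF T, of "(- x, x)"] by (simp add: norm_prod_def ac_simps)
qed

text \<open>
  Without injectivity the bound can fail: for \<open>S = 0\<close> the infimum is over the empty set and is
  infinite. The zero space is excluded for the same reason.
\<close>

lemma reduced_min_modulus_le:
  assumes "hilbert_space H1" "bounded_linear S" "null_space S = {0}"
    and "\<exists>x :: 'a. x \<noteq> 0"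
    and bound: "\<And>x. norm (S x) \<le> c * norm x"
  shows "reduced_min_modulus (H1 :: ('k::real_or_complex, 'a::banach) hilbert) S \<le> ereal c"
proof -
  obtain x :: 'a where "x \<noteq> 0"
    using assms(4) by blast
  define u where "u = x /\<^sub>R norm x"
  have u: "norm u = 1"
    using \<open>x \<noteq> 0\<close> by (simp add: u_def)
  have "u \<in> orth_compl H1 (null_space S)"
    by (simp add: orth_compl_def assms(3) hilbert_space.ip_zero_right[OF assms(1)])
  then have "reduced_min_modulus H1 S \<le> ereal (norm (S u))"
    unfolding reduced_min_modulus_def using u by (intro INF_lower) simp
  also have "\<dots> \<le> ereal c"
    using bound[of u] u by simp
  finally show ?thesis .
qed

lemma bounded_below_imp_null_space:
  assumes "bounded_linear S" "bounded_below S"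
  shows "null_space S = {0}"
proof -
  obtain c where c: "c > 0" "\<And>x. c * norm x \<le> norm (S x)"
    using assms(2) by (auto simp: bounded_below_def)
  have "x = 0" if "S x = 0" for x
    using c(1) c(2)[of x] that by (simp add: mult_le_0_iff)
  then show ?thesis
    using linear_0[OF bounded_linear.linear[OF assms(1)]] by (auto simp: null_space_def)
qed

theorem proposition4p2:
  fixes H1 :: "('k::real_or_complex, 'a::banach) hilbert"
    and H2 :: "('k, 'b::banach) hilbert"
    and A B :: "'a \<Rightarrow> 'b"
    and T :: "'a \<times> 'a \<Rightarrow> 'b \<times> 'b"
    and M :: "('a \<times> 'a) set" and N :: "('b \<times> 'b) set"
    and l :: real
  assumes "hilbert_space H1" and "hilbert_space H2"
    and "bounded_op H1 H2 A" and "bounded_op H1 H2 B"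
    and "M = UNIV \<times> {0}" and "N = UNIV \<times> {0}"
    and "T = block_op A A A (\<lambda>x. A x + B x)"
    and "l > 0"
    and "complementable (hilbert_sum H1 H1) (hilbert_sum H2 H2) M N l T"
  shows "onorm T \<le> sqrt (3 * l\<^sup>2 + 1) * onorm (\<lambda>x. A x + B x) \<and>
    ((\<exists>x :: 'a. x \<noteq> 0) \<and>
     (\<forall>x. adj H1 H2 A (2 *\<^sub>R A x + B x) = 0) \<and>
     bounded_below (parallel_sum H1 A B) \<and> bounded_below B \<longrightarrow>
       min (reduced_min_modulus H1 (parallel_sum H1 A B) / ereal (1 + l))
           (reduced_min_modulus H1 B / 2) \<le> ereal (onorm T) \<and>
       onorm T \<le> sqrt (3 * l\<^sup>2 + 1) * onorm (\<lambda>x. A x + B x))"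
proof -
  have A: "bounded_linear A" and B: "bounded_linear B"
    using bounded_op_imp_bounded_linear assms(1-4) by blast+
  have AB: "bounded_linear (\<lambda>x. A x + B x)"
    by (intro bounded_linear_add A B)
  have T: "bounded_linear T"
    unfolding assms(7) by (intro bounded_linear_block_op A AB)
  have "A ` cball 0 1 \<subseteq> (*\<^sub>R) l ` (\<lambda>x. A x + B x) ` cball 0 1"
    using assms(9) linear_0[OF bounded_linear.linear[OF A]] linear_0[OF bounded_linear.linear[OF AB]]
    unfolding assms(5-7) by (intro complementable_block_opD[OF assms(1,1,2,2)]) auto
  then have "onorm A \<le> l * onorm (\<lambda>x. A x + B x)"
    using assms(8) by (intro onorm_le_of_image_cball_subset A AB) auto
  then have sq: "(onorm A)\<^sup>2 \<le> l\<^sup>2 * (onorm (\<lambda>x. A x + B x))\<^sup>2"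
    using power_mono[of "onorm A" _ 2] onorm_pos_le[OF A] by (fastforce simp: power_mult_distrib)
  have "onorm T \<le> sqrt ((onorm A)\<^sup>2 + (onorm A)\<^sup>2 + (onorm A)\<^sup>2 + (onorm (\<lambda>x. A x + B x))\<^sup>2)"
    unfolding assms(7) by (rule onorm_block_op_le[OF A A A AB])
  also have "\<dots> \<le> sqrt ((3 * l\<^sup>2 + 1) * (onorm (\<lambda>x. A x + B x))\<^sup>2)"
    using sq by (intro real_sqrt_le_mono) (simp add: algebra_simps)
  also have "\<dots> = sqrt (3 * l\<^sup>2 + 1) * onorm (\<lambda>x. A x + B x)"
    using onorm_pos_le[OF AB] by (simp add: real_sqrt_mult)
  finally have upper: "onorm T \<le> sqrt (3 * l\<^sup>2 + 1) * onorm (\<lambda>x. A x + B x)" .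
  have lower: "reduced_min_modulus H1 B / 2 \<le> ereal (onorm T)"
    if "\<exists>x :: 'a. x \<noteq> 0" "bounded_below B"
  proof -
    have "sqrt 2 \<le> 2"
      by (rule real_le_lsqrt) simp_all
    then have "sqrt 2 * onorm T * norm x \<le> 2 * onorm T * norm x" for x :: 'a
      using onorm_pos_le[OF T] by (intro mult_right_mono) auto
    then have "norm (B x) \<le> 2 * onorm T * norm x" for x
      using norm_le_onorm_block_op[OF A B, of x] unfolding assms(7) by (rule order_trans[rotated])
    then have "reduced_min_modulus H1 B \<le> ereal (2 * onorm T)"
      using that B by (intro reduced_min_modulus_le[OF assms(1)] bounded_below_imp_null_space) auto
    then have "reduced_min_modulus H1 B / 2 \<le> ereal (2 * onorm T) / 2"
      by (intro ereal_divide_right_mono) auto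
    also have "\<dots> = ereal (onorm T)"
      by simp
    finally show ?thesis .
  qed
  show ?thesis
    using upper lower by (auto intro: min.coboundedI2)
qed

end
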